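(* Let $T$ be a maximal dissipative operator in a complex Hilbert space $\mathcal H$. If $T\in\mathbf D_{\rm sing}$ and $\mathfrak S_T=\{f\in\mathrm{dom}\,T:\mathrm{Im}(Tf,f)=0\}$ is non-trivial (i.e. $\ne\{0\}$) and non-dense in $\mathcal H$, then the deficiency indices of the Hermitian part $T\upharpoonright\mathfrak S_T$ of $T$ are infinite.
   Context: A linear operator $T$ in $\mathcal H$ is dissipative if $\mathrm{Im}(Tf,f)\ge 0$ for all $f\in\mathrm{dom}\,T$, and maximal dissipative if it is dissipative and has no proper dissipative (operator) extension in $\mathcal H$. $T\in\mathbf D_{\rm sing}$ means that $T$ is maximal dissipative and for every $f\in\mathrm{dom}\,T$ there is a sequence $\{f_n\}\subset\mathrm{dom}\,T$ with $f_n\to f$ in $\mathcal H$ and $\mathrm{Im}(Tf_n,f_n)\to0$. The set $\mathfrak S_T$ is a linear manifold and the Hermitian part $S=T\upharpoonright\mathfrak S_T$ is a closed symmetric operator ($\mathrm{Im}(Sf,f)=0$ for all $f\in\mathrm{dom}\,S$). Its deficiency indices are $n_+=\dim\,(\mathrm{ran}(S-\bar\lambda I))^\perp$ for $\mathrm{Im}\,\lambda>0$ and $n_-=\dim\,(\mathrm{ran}(S-\bar\lambda I))^\perp$ for $\mathrm{Im}\,\lambda<0$.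
   Formalization: T is additionally assumed densely defined (for a maximal dissipative operator this is equivalent to being closed); with maximality only among operator extensions and no density assumption, the claim is false. *)

theory Defs
  imports "HOL-Analysis.Analysis" "HOL-Library.Extended_Nat"
begin

text \<open>
  Complex Hilbert spaces, with no separability or dimension restriction. The inner product is
  linear in the first argument. Completeness, the metric and the topology come from the class
  of Banach spaces, to which the last axiom links the inner product; positive definiteness
  follows from that axiom.
\<close>

class complex_hilbert_space = banach +
  fixes scaleC :: "complex \<Rightarrow> 'a \<Rightarrow> 'a" (infixr "*\<^sub>C" 75)
    and cinner :: "'a \<Rightarrow> 'a \<Rightarrow> complex"
  assumes scaleC_add_right: "c *\<^sub>C (x + y) = c *\<^sub>C x + c *\<^sub>C y"
    and scaleC_add_left: "(c + d) *\<^sub>C x = c *\<^sub>C x + d *\<^sub>C x"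
    and scaleC_scaleC: "c *\<^sub>C d *\<^sub>C x = (c * d) *\<^sub>C x"
    and scaleC_one: "1 *\<^sub>C x = x"
    and scaleR_scaleC: "r *\<^sub>R x = complex_of_real r *\<^sub>C x"
    and cinner_add_left: "cinner (x + y) z = cinner x z + cinner y z"
    and cinner_scaleC_left: "cinner (c *\<^sub>C x) y = c * cinner x y"
    and cinner_commute: "cinner x y = cnj (cinner y x)"
    and norm_eq_sqrt_cinner: "norm x = sqrt (Re (cinner x x))"

global_interpretation complex_vector:
  vector_space "scaleC :: complex \<Rightarrow> 'a \<Rightarrow> 'a::complex_hilbert_space"
  by standard (simp_all add: scaleC_add_right scaleC_add_left scaleC_scaleC scaleC_one)

instantiation complex :: complex_hilbert_space
begin

definition scaleC_complex :: "complex \<Rightarrow> complex \<Rightarrow> complex"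
  where "scaleC_complex c x = c * x"

definition cinner_complex :: "complex \<Rightarrow> complex \<Rightarrow> complex"
  where "cinner_complex x y = x * cnj y"

instance
  by standard
    (simp_all add: scaleC_complex_def cinner_complex_def algebra_simps scaleR_conv_of_real
      cmod_def power2_eq_square)

end

definition cdim :: "'a::complex_hilbert_space set \<Rightarrow> enat"
  where "cdim M = (if \<exists>B. finite B \<and> M \<subseteq> complex_vector.span B
                   then enat (complex_vector.dim M) else \<infinity>)"

definition ortho_complement :: "'a::complex_hilbert_space set \<Rightarrow> 'a set"
  where "ortho_complement M = {x. \<forall>y\<in>M. cinner x y = 0}"

text \<open>
  An unbounded operator is given by its domain \<open>D\<close> and a total function \<open>T\<close> whose values outside
  \<open>D\<close> are irrelevant. Its restriction to \<open>D' \<subseteq> D\<close> is therefore given by \<open>D'\<close> and the same \<open>T\<close>.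
\<close>

definition linear_operator :: "'a::complex_hilbert_space set \<Rightarrow> ('a \<Rightarrow> 'a) \<Rightarrow> bool"
  where "linear_operator D T \<longleftrightarrow>
    complex_vector.subspace D \<and>
    (\<forall>f\<in>D. \<forall>g\<in>D. T (f + g) = T f + T g) \<and>
    (\<forall>c. \<forall>f\<in>D. T (c *\<^sub>C f) = c *\<^sub>C T f)"

definition densely_defined :: "'a::complex_hilbert_space set \<Rightarrow> ('a \<Rightarrow> 'a) \<Rightarrow> bool"
  where "densely_defined D T \<longleftrightarrow> closure D = UNIV"

definition dissipative :: "'a::complex_hilbert_space set \<Rightarrow> ('a \<Rightarrow> 'a) \<Rightarrow> bool"
  where "dissipative D T \<longleftrightarrow> linear_operator D T \<and> (\<forall>f\<in>D. Im (cinner (T f) f) \<ge> 0)"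

definition extends_op ::
  "'a::complex_hilbert_space set \<Rightarrow> ('a \<Rightarrow> 'a) \<Rightarrow> 'a set \<Rightarrow> ('a \<Rightarrow> 'a) \<Rightarrow> bool"
  where "extends_op D' T' D T \<longleftrightarrow> D \<subseteq> D' \<and> (\<forall>f\<in>D. T' f = T f)"

text \<open>
  Maximality among operators does not by itself force a dense domain: if \<open>A\<close> is self-adjoint in
  the orthogonal complement of a unit vector \<open>h\<close> and \<open>\<phi>\<close> is a linear functional on the domain of
  \<open>A\<close> that is unbounded for the graph norm, then \<open>f \<mapsto> A f + \<phi>(f) h\<close> satisfies the predicate below.
\<close>

definition maximal_dissipative :: "'a::complex_hilbert_space set \<Rightarrow> ('a \<Rightarrow> 'a) \<Rightarrow> bool"
  where "maximal_dissipative D T \<longleftrightarrow>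
    dissipative D T \<and>
    (\<forall>D' T'. dissipative D' T' \<and> extends_op D' T' D T \<longrightarrow> D' = D)"

definition D_sing :: "'a::complex_hilbert_space set \<Rightarrow> ('a \<Rightarrow> 'a) \<Rightarrow> bool"
  where "D_sing D T \<longleftrightarrow>
    maximal_dissipative D T \<and>
    (\<forall>f\<in>D. \<exists>s. (\<forall>n. s n \<in> D) \<and> s \<longlonglongrightarrow> f \<and>
       (\<lambda>n. Im (cinner (T (s n)) (s n))) \<longlonglongrightarrow> 0)"

definition hermitian_domain :: "'a::complex_hilbert_space set \<Rightarrow> ('a \<Rightarrow> 'a) \<Rightarrow> 'a set"
  where "hermitian_domain D T = {f \<in> D. Im (cinner (T f) f) = 0}"

text \<open>
  For a symmetric operator this number depends only on the sign of \<open>Im z\<close>; the deficiency index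
  \<open>n\<^sub>+\<close> is its value for \<open>Im z > 0\<close>, and \<open>n\<^sub>-\<close> its value for \<open>Im z < 0\<close>.
\<close>

definition deficiency_index ::
  "'a::complex_hilbert_space set \<Rightarrow> ('a \<Rightarrow> 'a) \<Rightarrow> complex \<Rightarrow> enat"
  where "deficiency_index D S z = cdim (ortho_complement ((\<lambda>f. S f - cnj z *\<^sub>C f) ` D))"

end

theory Submission
  imports Defs
begin

text \<open>
  Write \<open>q f = Im (T f, f)\<close> and let \<open>S\<close> be the kernel of this nonnegative form on \<open>D\<close>, the domain of
  the Hermitian part. The argument is by contraposition: one finite deficiency index forces \<open>S\<close> to
  be dense.

  Fix \<open>w\<close> in the upper half plane. The identity
  \<open>\<parallel>(T - cnj w) f\<parallel>\<^sup>2 = \<parallel>(T - w) f\<parallel>\<^sup>2 + 4 Im w q f\<close> says that the Cayley transform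
  \<open>(T - cnj w) f \<mapsto> (T - w) f\<close> is a contraction, and that it is isometric exactly on
  \<open>M = (T - cnj w) S\<close>. In its polarised form it says that the vectors of the range of
  \<open>T - cnj w\<close> orthogonal to \<open>M\<close> are mapped into the orthogonal complement of \<open>N = (T - w) S\<close>.
  The two deficiency spaces are \<open>M\<^sup>\<bottom>\<close> and \<open>N\<^sup>\<bottom>\<close>.

  If one of them is finite-dimensional, then \<open>q k \<ge> c \<parallel>(T - cnj w) k\<parallel>\<^sup>2\<close> with some \<open>c > 0\<close>
  whenever \<open>(T - cnj w) k \<in> M\<^sup>\<bottom>\<close> (\<open>coercive_if_finite_deficiency\<close>). Otherwise there are such
  \<open>k n\<close> with \<open>\<parallel>(T - cnj w) (k n)\<parallel> = 1\<close> and \<open>q (k n) \<rightarrow> 0\<close>. Local compactness of the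
  finite-dimensional space makes one of the sequences \<open>(T - cnj w) (k n)\<close>, \<open>(T - w) (k n)\<close>
  converge along a subsequence, and the identity passes convergence from the second to the first.
  As \<open>T\<close> is closed, the limit is \<open>(T - cnj w) f\<close> with \<open>q f = 0\<close>: a unit vector in \<open>M \<inter> M\<^sup>\<bottom>\<close>.

  Now let \<open>f \<in> D\<close>. By hypothesis \<open>f\<close> is a limit of \<open>s n \<in> D\<close> with \<open>q (s n) \<rightarrow> 0\<close>. Project
  \<open>(T - cnj w) (s n)\<close> onto the closed subspace \<open>M\<close>, and let \<open>(T - cnj w) (a n)\<close> with \<open>a n \<in> S\<close>
  be the projection. Coercivity bounds \<open>\<parallel>s n - a n\<parallel>\<^sup>2\<close> by a multiple of \<open>q (s n - a n)\<close>,
  which is at most \<open>2 q (s n)\<close> since \<open>q\<close> vanishes at \<open>a n\<close>. So \<open>a n \<rightarrow> f\<close>, the set \<open>S\<close> is dense in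
  \<open>D\<close>, and \<open>D\<close> is dense in the space.

  Maximality enters through the closedness of \<open>T\<close> (\<open>closed_graph\<close>): adding a limit point to the graph
  preserves dissipativity, so a maximal operator is already defined there, and the density of \<open>D\<close>
  leaves only one possible value.
\<close>

section \<open>Geometry of complex Hilbert spaces\<close>

lemma cinner_add_right: "cinner x (y + z) = cinner x y + cinner x z"
  for x :: "'a::complex_hilbert_space"
  by (metis cinner_add_left cinner_commute complex_cnj_add)

lemma cinner_scaleC_right: "cinner x (c *\<^sub>C y) = cnj c * cinner x y"
  for x :: "'a::complex_hilbert_space"
  by (metis cinner_commute cinner_scaleC_left complex_cnj_mult)

lemma cinner_minus_left: "cinner (- x) y = - cinner x y"
  for x :: "'a::complex_hilbert_space"
  using cinner_scaleC_left[of "-1" x y] by simp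

lemma cinner_minus_right: "cinner x (- y) = - cinner x y"
  for x :: "'a::complex_hilbert_space"
  using cinner_scaleC_right[of x "-1" y] by simp

lemma cinner_diff_left: "cinner (x - y) z = cinner x z - cinner y z"
  for x :: "'a::complex_hilbert_space"
  by (simp only: diff_conv_add_uminus cinner_add_left cinner_minus_left)

lemma cinner_diff_right: "cinner x (y - z) = cinner x y - cinner x z"
  for x :: "'a::complex_hilbert_space"
  by (simp only: diff_conv_add_uminus cinner_add_right cinner_minus_right)

lemmas cinner_simps = cinner_add_left cinner_add_right cinner_diff_left cinner_diff_right
  cinner_scaleC_left cinner_scaleC_right

lemma cinner_self: "cinner x x = complex_of_real ((norm x)\<^sup>2)"
  for x :: "'a::complex_hilbert_space"
proof -
  have "0 \<le> Re (cinner x x)"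
    using norm_ge_zero[of x] by (simp add: norm_eq_sqrt_cinner)
  moreover have "Im (cinner x x) = 0"
    using cinner_commute[of x x] by (metis cnj.simps(2) equal_neg_zero)
  ultimately show ?thesis
    by (simp add: norm_eq_sqrt_cinner complex_eq_iff)
qed

lemma power2_norm_eq_cinner: "(norm x)\<^sup>2 = Re (cinner x x)"
  for x :: "'a::complex_hilbert_space"
  by (simp add: cinner_self)

lemma cinner_zero [simp]: "cinner 0 y = 0" "cinner y 0 = 0"
  for y :: "'a::complex_hilbert_space"
  using cinner_minus_left[of 0 y] cinner_minus_right[of y 0] by auto

lemma norm_scaleC: "norm (c *\<^sub>C x) = cmod c * norm x"
  for x :: "'a::complex_hilbert_space"
proof -
  have "cinner (c *\<^sub>C x) (c *\<^sub>C x) = (c * cnj c) * cinner x x"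
    by (simp only: cinner_scaleC_left cinner_scaleC_right ac_simps)
  also have "\<dots> = complex_of_real ((cmod c * norm x)\<^sup>2)"
    by (simp only: cinner_self power_mult_distrib of_real_mult complex_norm_square)
  finally have "Re (cinner (c *\<^sub>C x) (c *\<^sub>C x)) = (cmod c * norm x)\<^sup>2"
    by simp
  then have "(norm (c *\<^sub>C x))\<^sup>2 = (cmod c * norm x)\<^sup>2"
    by (simp add: power2_norm_eq_cinner)
  then show ?thesis
    by (simp add: power2_eq_iff_nonneg)
qed

lemma parallelogram:
  "(norm (x + y))\<^sup>2 + (norm (x - y))\<^sup>2 = 2 * (norm x)\<^sup>2 + 2 * (norm y)\<^sup>2"
  for x y :: "'a::complex_hilbert_space"
  by (simp add: power2_norm_eq_cinner cinner_simps)

lemma power2_norm_add_scaleC: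
  "(norm (x + c *\<^sub>C y))\<^sup>2 = (norm x)\<^sup>2 + 2 * Re (cnj c * cinner x y) + (cmod c)\<^sup>2 * (norm y)\<^sup>2"
  for x y :: "'a::complex_hilbert_space"
proof -
  have "Re (c * cinner y x) = Re (cnj c * cinner x y)"
    by (subst cinner_commute) simp
  moreover have "(norm (x + c *\<^sub>C y))\<^sup>2 =
      (norm x)\<^sup>2 + Re (cnj c * cinner x y) + Re (c * cinner y x) + (norm (c *\<^sub>C y))\<^sup>2"
    by (simp add: power2_norm_eq_cinner cinner_simps algebra_simps)
  ultimately show ?thesis
    by (simp add: norm_scaleC power_mult_distrib)
qed

lemma cauchy_schwarz: "cmod (cinner x y) \<le> norm x * norm y"
  for x y :: "'a::complex_hilbert_space"
proof (cases "y = 0")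
  case False
  define c where "c = - cinner x y / complex_of_real ((norm y)\<^sup>2)"
  have *: "cnj c * cinner x y = - complex_of_real ((cmod (cinner x y))\<^sup>2 / (norm y)\<^sup>2)"
    using complex_norm_square[of "cinner x y"] by (simp add: c_def mult.commute)
  have "cmod c = cmod (cinner x y) / (norm y)\<^sup>2"
    by (simp add: c_def norm_divide norm_power)
  then have "(cmod c)\<^sup>2 * (norm y)\<^sup>2 = (cmod (cinner x y))\<^sup>2 / (norm y)\<^sup>2"
    using False by (simp add: power_divide power2_eq_square)
  then have "0 \<le> (norm x)\<^sup>2 - (cmod (cinner x y))\<^sup>2 / (norm y)\<^sup>2"
    using power2_norm_add_scaleC[of x c y] zero_le_power2[of "norm (x + c *\<^sub>C y)"]
    unfolding * by simp
  then have "(cmod (cinner x y))\<^sup>2 \<le> (norm x * norm y)\<^sup>2"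
    using False by (simp add: field_simps power_mult_distrib)
  then show ?thesis
    by (simp add: power2_le_iff_abs_le)
qed simp

lemma bounded_bilinear_cinner:
  "bounded_bilinear (cinner :: 'a::complex_hilbert_space \<Rightarrow> 'a \<Rightarrow> complex)"
proof
  fix x y :: 'a and r :: real
  show "cinner (r *\<^sub>R x) y = r *\<^sub>R cinner x y" "cinner x (r *\<^sub>R y) = r *\<^sub>R cinner x y"
    by (simp_all add: scaleR_scaleC[of r x] scaleR_scaleC[of r y] cinner_simps scaleR_conv_of_real)
qed (auto simp: cinner_simps intro!: exI[of _ 1] cauchy_schwarz)

lemma bounded_bilinear_scaleC:
  "bounded_bilinear (scaleC :: complex \<Rightarrow> 'a::complex_hilbert_space \<Rightarrow> 'a)"
proof
  fix x :: 'a and c :: complex and r :: real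
  show "(r *\<^sub>R c) *\<^sub>C x = r *\<^sub>R (c *\<^sub>C x)" "c *\<^sub>C (r *\<^sub>R x) = r *\<^sub>R (c *\<^sub>C x)"
    unfolding scaleR_scaleC[of r x] scaleR_scaleC[of r "c *\<^sub>C x"] scaleC_scaleC
      scaleR_conv_of_real by (simp_all only: mult.commute)
qed (auto simp: scaleC_add_left scaleC_add_right norm_scaleC intro!: exI[of _ 1])

lemmas tendsto_cinner = bounded_bilinear.tendsto[OF bounded_bilinear_cinner]
lemmas tendsto_scaleC = bounded_bilinear.tendsto[OF bounded_bilinear_scaleC]

text \<open>
  For \<open>c\<close> of small modulus the linear term dominates, and its sign is free to choose. This turns a
  minimum of a quadratic form into an orthogonality relation.
\<close>

lemma zero_if_quadratic_nonneg:
  fixes a :: complex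
  assumes "\<And>c. 0 \<le> Re (c * a) + (cmod c)\<^sup>2 * r"
  shows "a = 0"
proof (rule ccontr)
  assume "a \<noteq> 0"
  define t where "t = 1 / (\<bar>r\<bar> + 1)"
  have t: "t > 0" "t * r < 1"
    by (auto simp: t_def divide_simps)
  define c where "c = - complex_of_real t * cnj a"
  have "c * a = - complex_of_real (t * (cmod a)\<^sup>2)"
    using complex_norm_square[of a] by (simp add: c_def mult.commute mult.assoc)
  then have "Re (c * a) = - (t * (cmod a)\<^sup>2)"
    by simp
  moreover have "(cmod c)\<^sup>2 = t\<^sup>2 * (cmod a)\<^sup>2"
    using t by (simp add: c_def norm_mult power_mult_distrib)
  ultimately have "0 \<le> t * (cmod a)\<^sup>2 * (t * r - 1)"
    using assms[of c] by (simp add: algebra_simps power2_eq_square)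
  moreover have "t * (cmod a)\<^sup>2 * (t * r - 1) < 0"
    using t \<open>a \<noteq> 0\<close> by (intro mult_pos_neg mult_pos_pos) auto
  ultimately show False
    by simp
qed

text \<open>
  By the parallelogram law a sequence in \<open>M\<close> that minimises the distance to \<open>x\<close> is Cauchy. Its
  limit \<open>m\<close> is a nearest point, and minimality makes \<open>x - m\<close> orthogonal to \<open>M\<close>.
\<close>

theorem orthogonal_decomposition:
  fixes M :: "'a::complex_hilbert_space set"
  assumes sub: "complex_vector.subspace M" and "closed M"
  obtains m p where "m \<in> M" "p \<in> ortho_complement M" "x = m + p"
proof -
  define d where "d = infdist x M"
  have M0: "M \<noteq> {}"
    using complex_vector.subspace_0[OF sub] by auto
  have "\<exists>y\<in>M. dist x y < d + inverse (Suc n)" for n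
  proof (rule ccontr)
    assume "\<not> ?thesis"
    then have "d + inverse (Suc n) \<le> (INF y\<in>M. dist x y)"
      using M0 by (intro cINF_greatest) (auto simp: not_less)
    then have "inverse (real (Suc n)) \<le> 0"
      using M0 by (simp add: d_def infdist_notempty)
    moreover have "inverse (real (Suc n)) > 0"
      by simp
    ultimately show False
      by linarith
  qed
  then obtain y where y: "\<And>n. y n \<in> M" "\<And>n. dist x (y n) < d + inverse (Suc n)"
    by metis
  have d_le: "d \<le> norm (x - z)" if "z \<in> M" for z
    using infdist_le[OF that, of x] by (simp add: d_def dist_norm)
  have d0: "0 \<le> d"
    by (simp add: d_def infdist_nonneg)
  define r where "r n = (d + inverse (Suc n))\<^sup>2 - d\<^sup>2" for n :: nat
  have r0: "r \<longlonglongrightarrow> 0"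
    unfolding r_def by (rule tendsto_eq_intros LIMSEQ_inverse_real_of_nat refl | simp)+
  have close: "(norm (y m - y n))\<^sup>2 \<le> 2 * r m + 2 * r n" for m n
  proof -
    have two: "2 *\<^sub>C x = x + x"
      by (metis one_add_one scaleC_add_left scaleC_one)
    \<comment> \<open>The midpoint lies in \<open>M\<close>, so the sum of the two errors has norm at least \<open>2 d\<close>.\<close>
    have "(1/2) *\<^sub>C (y m + y n) \<in> M"
      using y(1) sub complex_vector.subspace_add complex_vector.subspace_scale by blast
    from d_le[OF this] have "d \<le> norm (x - (1/2) *\<^sub>C (y m + y n))" .
    moreover have "(x - y m) + (x - y n) = 2 *\<^sub>C (x - (1/2) *\<^sub>C (y m + y n))"
      by (simp add: complex_vector.scale_right_diff_distrib scaleC_scaleC scaleC_one two)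
    ultimately have "2 * d \<le> norm ((x - y m) + (x - y n))"
      by (simp add: norm_scaleC)
    then have "(2 * d)\<^sup>2 \<le> (norm ((x - y m) + (x - y n)))\<^sup>2"
      using d0 by (intro power_mono) auto
    moreover have "(norm (x - y k))\<^sup>2 \<le> (d + inverse (Suc k))\<^sup>2" for k
      using y(2)[of k] by (intro power_mono) (auto simp: dist_norm)
    from this[of m] this[of n] have
      "2 * (norm (x - y m))\<^sup>2 + 2 * (norm (x - y n))\<^sup>2 \<le> 2 * r m + 2 * r n + 4 * d\<^sup>2"
      by (simp add: r_def algebra_simps)
    ultimately show ?thesis
      using parallelogram[of "x - y m" "x - y n"]
      by (simp add: norm_minus_commute power_mult_distrib)
  qed
  have "Cauchy y"
  proof (rule metric_CauchyI)
    fix e :: real assume "0 < e"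
    then have "\<forall>\<^sub>F n in sequentially. r n < e\<^sup>2 / 4"
      by (intro order_tendstoD[OF r0]) auto
    then obtain N where N: "\<And>n. n \<ge> N \<Longrightarrow> r n < e\<^sup>2 / 4"
      by (auto simp: eventually_sequentially)
    have "(norm (y m - y n))\<^sup>2 < e\<^sup>2" if "m \<ge> N" "n \<ge> N" for m n
      using close[of m n] N[OF that(1)] N[OF that(2)] by linarith
    then show "\<exists>N. \<forall>m\<ge>N. \<forall>n\<ge>N. dist (y m) (y n) < e"
      using \<open>0 < e\<close> by (auto simp: dist_norm intro!: exI[of _ N] power2_less_imp_less[of _ e])
  qed
  then obtain m where m: "y \<longlonglongrightarrow> m"
    by (metis Cauchy_convergent convergent_def)
  then have "m \<in> M"
    using closed_sequentially[OF \<open>closed M\<close>] y(1) by blast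
  have "norm (x - m) \<le> d"
  proof (rule LIMSEQ_le)
    show "(\<lambda>n. norm (x - y n)) \<longlonglongrightarrow> norm (x - m)"
      by (intro tendsto_intros m)
    show "(\<lambda>n. d + inverse (Suc n)) \<longlonglongrightarrow> d"
      by (rule tendsto_eq_intros LIMSEQ_inverse_real_of_nat refl | simp)+
    show "\<exists>N. \<forall>n\<ge>N. norm (x - y n) \<le> d + inverse (Suc n)"
      using y(2) by (auto simp: dist_norm intro: less_imp_le)
  qed
  have "cinner (x - m) z = 0" if "z \<in> M" for z
  proof (rule zero_if_quadratic_nonneg)
    fix c
    have "m - (cnj c / 2) *\<^sub>C z \<in> M"
      using \<open>m \<in> M\<close> that sub
      by (meson complex_vector.subspace_diff complex_vector.subspace_scale)
    then have "norm (x - m) \<le> norm ((x - m) + (cnj c / 2) *\<^sub>C z)"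
      using d_le \<open>norm (x - m) \<le> d\<close> by (fastforce simp: algebra_simps)
    then have "(norm (x - m))\<^sup>2 \<le> (norm ((x - m) + (cnj c / 2) *\<^sub>C z))\<^sup>2"
      by (intro power_mono) auto
    then show "0 \<le> Re (c * cinner (x - m) z) + (cmod c)\<^sup>2 * ((norm z)\<^sup>2 / 4)"
      unfolding power2_norm_add_scaleC by (simp add: norm_divide power_divide diff_divide_distrib)
  qed
  then have "x - m \<in> ortho_complement M"
    by (simp add: ortho_complement_def)
  with \<open>m \<in> M\<close> show thesis
    by (intro that[of m "x - m"]) auto
qed

lemma subspace_ortho_complement: "complex_vector.subspace (ortho_complement M)"
  for M :: "'a::complex_hilbert_space set"
  unfolding complex_vector.subspace_def ortho_complement_def
  by (auto simp: cinner_simps)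

lemma closed_ortho_complement: "closed (ortho_complement M)"
  for M :: "'a::complex_hilbert_space set"
  unfolding closed_sequential_limits
proof (intro allI impI)
  fix s :: "nat \<Rightarrow> 'a" and l
  assume "(\<forall>n. s n \<in> ortho_complement M) \<and> s \<longlonglongrightarrow> l"
  then have "cinner l y = 0" if "y \<in> M" for y
    using tendsto_cinner[of s l sequentially "\<lambda>_. y" y] that
    by (auto simp: ortho_complement_def LIMSEQ_const_iff)
  then show "l \<in> ortho_complement M"
    by (simp add: ortho_complement_def)
qed

text \<open>
  Finite-dimensional subspaces are locally compact. In the induction step the new vector is replaced
  by its component \<open>e\<close> orthogonal to the old span \<open>V\<close>; a bound on \<open>y + c e\<close> with \<open>y \<in> V\<close> then bounds
  \<open>y\<close> and \<open>c\<close> separately, by Pythagoras. The decomposition requires \<open>V\<close> to be closed, which is a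
  consequence of its local compactness.
\<close>

lemma compact_span_cball:
  fixes B :: "'a::complex_hilbert_space set"
  assumes "finite B"
  shows "compact (complex_vector.span B \<inter> cball 0 r)"
  using assms
proof (induction B arbitrary: r rule: finite_induct)
  case empty
  then show ?case
    by (simp add: Int_insert_left)
next
  case (insert b B)
  let ?V = "complex_vector.span B"
  have sub: "complex_vector.subspace ?V"
    by simp
  have "closed ?V"
    unfolding closed_sequential_limits
  proof (intro allI impI, elim conjE)
    fix s :: "nat \<Rightarrow> 'a" and l
    assume s: "\<forall>n. s n \<in> ?V" "s \<longlonglongrightarrow> l"
    then obtain K where "\<And>n. norm (s n) \<le> K"
      by (metis Bseq_def convergentI convergent_imp_Bseq)
    then have "\<forall>n. s n \<in> ?V \<inter> cball 0 K"
      using s(1) by simp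
    then have "l \<in> ?V \<inter> cball 0 K"
      using closed_sequentially[OF compact_imp_closed[OF insert.IH]] s(2) by blast
    then show "l \<in> ?V"
      by simp
  qed
  then obtain m e where me: "m \<in> ?V" "e \<in> ortho_complement ?V" "b = m + e"
    by (rule orthogonal_decomposition[OF sub])
  show ?case
  proof (cases "e = 0")
    case True
    then have "complex_vector.span (insert b B) = ?V"
      using me by (simp add: complex_vector.span_redundant)
    then show ?thesis
      using insert.IH by simp
  next
    case False
    let ?g = "\<lambda>(y, c). y + c *\<^sub>C e"
    let ?K = "(?V \<inter> cball 0 r) \<times> cball (0::complex) (r / norm e)"
    have "compact (?g ` ?K)"
    proof (rule compact_continuous_image)
      show "continuous_on ?K ?g"
        unfolding case_prod_unfold
        by (intro continuous_intros bounded_bilinear.continuous_on[OF bounded_bilinear_scaleC])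
      show "compact ?K"
        by (intro compact_Times insert.IH compact_cball)
    qed
    moreover have "complex_vector.span (insert b B) \<inter> cball 0 r = ?g ` ?K \<inter> cball 0 r"
    proof (intro equalityI subsetI)
      fix x assume x: "x \<in> complex_vector.span (insert b B) \<inter> cball 0 r"
      then obtain c where c: "x - c *\<^sub>C b \<in> ?V"
        by (auto simp: complex_vector.span_insert)
      define y where "y = x - c *\<^sub>C e"
      have "y = (x - c *\<^sub>C b) + c *\<^sub>C m"
        by (simp add: y_def me(3) scaleC_add_right)
      then have "y \<in> ?V"
        using c me(1) by (simp add: complex_vector.span_add complex_vector.span_scale)
      then have "cinner e y = 0"
        using me(2) by (simp add: ortho_complement_def)
      then have "cinner y e = 0"
        by (subst cinner_commute) simp
      then have *: "(norm x)\<^sup>2 = (norm y)\<^sup>2 + (cmod c * norm e)\<^sup>2"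
        using power2_norm_add_scaleC[of y c e] by (simp add: y_def power_mult_distrib)
      have r: "norm x \<le> r"
        using x by simp
      have "norm y \<le> norm x"
        by (rule power2_le_imp_le) (auto simp: *)
      moreover have "cmod c * norm e \<le> norm x"
        by (rule power2_le_imp_le) (auto simp: *)
      ultimately have "(y, c) \<in> ?K"
        using r \<open>y \<in> ?V\<close> False by (auto simp: pos_le_divide_eq)
      moreover have "x = ?g (y, c)"
        by (simp add: y_def)
      ultimately show "x \<in> ?g ` ?K \<inter> cball 0 r"
        using x by blast
    next
      fix x assume x: "x \<in> ?g ` ?K \<inter> cball 0 r"
      then obtain y c where yc: "y \<in> ?V" "x = y + c *\<^sub>C e"
        by auto
      have "x - c *\<^sub>C b = y - c *\<^sub>C m"
        by (simp add: yc(2) me(3) scaleC_add_right)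
      then have "x - c *\<^sub>C b \<in> ?V"
        using yc(1) me(1) by (simp add: complex_vector.span_diff complex_vector.span_scale)
      then show "x \<in> complex_vector.span (insert b B) \<inter> cball 0 r"
        using x by (auto simp: complex_vector.span_insert)
    qed
    ultimately show ?thesis
      by (simp add: compact_Int_closed)
  qed
qed

lemma finite_cdim_convergent_subseq:
  fixes s :: "nat \<Rightarrow> 'a::complex_hilbert_space"
  assumes "cdim V \<noteq> \<infinity>" and "\<And>n. s n \<in> V" and "\<And>n. norm (s n) \<le> r"
  obtains l \<rho> where "strict_mono (\<rho> :: nat \<Rightarrow> nat)" "(s \<circ> \<rho>) \<longlonglongrightarrow> l"
proof -
  obtain B where B: "finite B" "V \<subseteq> complex_vector.span B"
    using assms(1) by (auto simp: cdim_def split: if_splits)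
  have "\<forall>n. s n \<in> complex_vector.span B \<inter> cball 0 r"
    using assms(2,3) B(2) by auto
  then show thesis
    using compact_span_cball[OF B(1), of r] that unfolding compact_def by meson
qed

section \<open>Maximal dissipative operators\<close>

locale dense_maximal_dissipative =
  fixes D :: "'a::complex_hilbert_space set" and T :: "'a \<Rightarrow> 'a"
  assumes dense: "densely_defined D T" and max: "maximal_dissipative D T"
begin

abbreviation q :: "'a \<Rightarrow> real" where "q f \<equiv> Im (cinner (T f) f)"

lemma subspace_D: "complex_vector.subspace D"
  and T_add: "f \<in> D \<Longrightarrow> g \<in> D \<Longrightarrow> T (f + g) = T f + T g"
  and T_scale: "f \<in> D \<Longrightarrow> T (c *\<^sub>C f) = c *\<^sub>C T f"
  and q_nonneg: "f \<in> D \<Longrightarrow> 0 \<le> q f"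
  using max by (auto simp: maximal_dissipative_def dissipative_def linear_operator_def)

lemma D_add: "f \<in> D \<Longrightarrow> g \<in> D \<Longrightarrow> f + g \<in> D"
  and D_diff: "f \<in> D \<Longrightarrow> g \<in> D \<Longrightarrow> f - g \<in> D"
  and D_scale: "f \<in> D \<Longrightarrow> c *\<^sub>C f \<in> D"
  and D_zero: "0 \<in> D"
  using subspace_D
  by (simp_all add: complex_vector.subspace_add complex_vector.subspace_diff
      complex_vector.subspace_scale complex_vector.subspace_0)

lemma T_diff:
  assumes "f \<in> D" "g \<in> D"
  shows "T (f - g) = T f - T g"
  using T_add[of "f - g" g] assms by (simp add: D_diff)

lemma T_zero: "T 0 = 0"
  using T_add[OF D_zero D_zero] by simp

lemma q_scale:
  assumes "f \<in> D"
  shows "q (c *\<^sub>C f) = (cmod c)\<^sup>2 * q f"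
proof -
  have "cinner (T (c *\<^sub>C f)) (c *\<^sub>C f) = (c * cnj c) * cinner (T f) f"
    by (simp only: T_scale[OF assms] cinner_scaleC_left cinner_scaleC_right ac_simps)
  then show ?thesis
    by (simp del: of_real_power flip: complex_norm_square)
qed

text \<open>
  The hypothesis says that assigning \<open>g\<close> to \<open>f\<close> keeps the operator dissipative, first for \<open>u + f\<close> and by
  homogeneity for all \<open>u + c f\<close>. If \<open>f\<close> were outside \<open>D\<close>, then \<open>u + c f \<mapsto> T u + c g\<close> would be a
  well-defined proper dissipative extension.
\<close>

lemma dissipative_extension_in_domain:
  assumes pos: "\<And>u. u \<in> D \<Longrightarrow> 0 \<le> Im (cinner (T u + g) (u + f))"
  shows "f \<in> D"
proof (rule ccontr)
  assume "f \<notin> D"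
  have pos': "0 \<le> Im (cinner (T u + c *\<^sub>C g) (u + c *\<^sub>C f))" if "u \<in> D" for u c
  proof (cases "c = 0")
    case True
    then show ?thesis
      using q_nonneg[OF that] by simp
  next
    case False
    define v where "v = inverse c *\<^sub>C u"
    have v: "v \<in> D" "u = c *\<^sub>C v"
      using that False by (simp_all add: v_def D_scale scaleC_scaleC scaleC_one)
    then have "T u + c *\<^sub>C g = c *\<^sub>C (T v + g)" "u + c *\<^sub>C f = c *\<^sub>C (v + f)"
      by (simp_all add: T_scale scaleC_add_right)
    then have "cinner (T u + c *\<^sub>C g) (u + c *\<^sub>C f) =
        complex_of_real ((cmod c)\<^sup>2) * cinner (T v + g) (v + f)"
      by (simp add: cinner_scaleC_left cinner_scaleC_right complex_norm_square
          mult.assoc[symmetric] del: of_real_power)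
    then show ?thesis
      using pos[OF v(1)] by simp
  qed
  define D' where "D' = {u + c *\<^sub>C f | u c. u \<in> D}"
  define dec where "dec x = (SOME (u, c). u \<in> D \<and> x = u + c *\<^sub>C f)" for x
  define T' where "T' x = (case dec x of (u, c) \<Rightarrow> T u + c *\<^sub>C g)" for x
  have T': "T' (u + c *\<^sub>C f) = T u + c *\<^sub>C g" if "u \<in> D" for u c
  proof -
    obtain u' c' where dec: "dec (u + c *\<^sub>C f) = (u', c')"
      by fastforce
    have "case dec (u + c *\<^sub>C f) of (u', c') \<Rightarrow> u' \<in> D \<and> u + c *\<^sub>C f = u' + c' *\<^sub>C f"
      unfolding dec_def by (rule someI[of _ "(u, c)"]) (use that in simp)
    then have u': "u' \<in> D" "u + c *\<^sub>C f = u' + c' *\<^sub>C f"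
      by (simp_all add: dec)
    have "c = c'"
    proof (rule ccontr)
      assume "c \<noteq> c'"
      have "(c - c') *\<^sub>C f = u' - u"
        using u'(2) by (simp add: complex_vector.scale_left_diff_distrib algebra_simps)
      then have "f = inverse (c - c') *\<^sub>C (u' - u)"
        using \<open>c \<noteq> c'\<close> by (metis complex_vector.scale_one complex_vector.scale_scale
            left_inverse right_minus_eq)
      then show False
        using \<open>f \<notin> D\<close> D_scale[OF D_diff[OF u'(1) that]] by metis
    qed
    with u' dec show ?thesis
      by (simp add: T'_def)
  qed
  have D'I: "u + c *\<^sub>C f \<in> D'" if "u \<in> D" for u c
    using that by (auto simp: D'_def)
  have add: "(u + c *\<^sub>C f) + (v + d *\<^sub>C f) = (u + v) + (c + d) *\<^sub>C f" for u v c d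
    by (simp add: scaleC_add_left)
  have scale: "c *\<^sub>C (u + d *\<^sub>C f) = c *\<^sub>C u + (c * d) *\<^sub>C f" for u c d
    by (simp add: scaleC_add_right scaleC_scaleC)
  have "complex_vector.subspace D'"
    unfolding complex_vector.subspace_def
  proof (intro conjI ballI allI)
    show "0 \<in> D'"
      using D'I[OF D_zero, of 0] by simp
    show "x + y \<in> D'" if "x \<in> D'" "y \<in> D'" for x y
      using that by (auto simp: D'_def) (metis D_add add)
    show "c *\<^sub>C x \<in> D'" if x: "x \<in> D'" for c x
    proof -
      obtain u d where "u \<in> D" "x = u + d *\<^sub>C f"
        using x by (auto simp: D'_def)
      then show ?thesis
        using D'I[OF D_scale, of u c "c * d"] by (simp add: scale)
    qed
  qed
  moreover have "T' (x + y) = T' x + T' y" if "x \<in> D'" "y \<in> D'" for x y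
  proof -
    from that obtain u c v d where uv: "u \<in> D" "v \<in> D" "x = u + c *\<^sub>C f" "y = v + d *\<^sub>C f"
      by (auto simp: D'_def)
    have "T' (x + y) = T (u + v) + (c + d) *\<^sub>C g"
      unfolding uv(3,4) add by (rule T'[OF D_add[OF uv(1,2)]])
    then show ?thesis
      using uv(1,2) by (simp add: uv(3,4) T' T_add scaleC_add_left)
  qed
  moreover have "T' (c *\<^sub>C x) = c *\<^sub>C T' x" if "x \<in> D'" for c x
    using that by (auto simp: D'_def scale T' D_scale T_scale scaleC_add_right scaleC_scaleC)
  moreover have "0 \<le> Im (cinner (T' x) x)" if "x \<in> D'" for x
    using that by (auto simp: D'_def T' pos')
  ultimately have "dissipative D' T'"
    by (auto simp: dissipative_def linear_operator_def)
  moreover have "extends_op D' T' D T"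
    unfolding extends_op_def using T'[where c = 0] D'I[where c = 0] by auto
  ultimately have "D' = D"
    using max unfolding maximal_dissipative_def by blast
  then show False
    using D'I[OF D_zero, of 1] \<open>f \<notin> D\<close> by (simp add: scaleC_one)
qed

text \<open>
  Maximality among operators does not by itself force \<open>T f = g\<close> when \<open>f\<close> already lies in \<open>D\<close>; here the
  density of \<open>D\<close> is essential. Inserting \<open>u = t v - f\<close> shows that
  \<open>\<bar>t\<bar>\<^sup>2 q v + Im (cnj t (g - T f, v)) \<ge> 0\<close> for all scalars \<open>t\<close>, whence \<open>g - T f\<close> is
  orthogonal to every \<open>v \<in> D\<close>.
\<close>

lemma dissipative_extension_in_graph:
  assumes pos: "\<And>u. u \<in> D \<Longrightarrow> 0 \<le> Im (cinner (T u + g) (u + f))"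
  shows "f \<in> D" "T f = g"
proof -
  show f: "f \<in> D"
    using pos by (rule dissipative_extension_in_domain)
  define e where "e = g - T f"
  have orth: "cinner e v = 0" if "v \<in> D" for v
  proof -
    have "- \<i> * cinner e v = 0"
    proof (rule zero_if_quadratic_nonneg)
      fix c
      define t where "t = cnj c"
      have "T (t *\<^sub>C v - f) + g = T (t *\<^sub>C v) + e"
        using f that by (simp add: T_diff D_scale e_def)
      then have "0 \<le> Im (cinner (T (t *\<^sub>C v) + e) (t *\<^sub>C v))"
        using pos[of "t *\<^sub>C v - f"] f that by (simp add: D_diff D_scale)
      moreover have "cinner (T (t *\<^sub>C v) + e) (t *\<^sub>C v) =
          cinner (T (t *\<^sub>C v)) (t *\<^sub>C v) + c * cinner e v"
        by (simp add: cinner_add_left cinner_scaleC_right t_def distrib_left)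
      ultimately have "0 \<le> q (t *\<^sub>C v) + Im (c * cinner e v)"
        by (simp only: plus_complex.simps)
      then show "0 \<le> Re (c * (- \<i> * cinner e v)) + (cmod c)\<^sup>2 * q v"
        using that by (simp add: q_scale t_def algebra_simps)
    qed
    then show ?thesis
      by simp
  qed
  have "e \<in> closure D"
    using dense by (simp add: densely_defined_def)
  then obtain s where s: "\<And>n. s n \<in> D" "s \<longlonglongrightarrow> e"
    by (auto simp: closure_sequential)
  have "(\<lambda>n. cinner e (s n)) \<longlonglongrightarrow> cinner e e"
    by (intro tendsto_cinner tendsto_const s)
  then have "cinner e e = 0"
    using orth s(1) by (simp add: LIMSEQ_const_iff)
  then show "T f = g"
    by (simp add: cinner_self e_def)
qed

lemma closed_graph:
  assumes "\<And>n. s n \<in> D" "s \<longlonglongrightarrow> f" "(\<lambda>n. T (s n)) \<longlonglongrightarrow> g"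
  shows "f \<in> D" "T f = g"
proof -
  have "0 \<le> Im (cinner (T u + g) (u + f))" if "u \<in> D" for u
  proof (rule LIMSEQ_le_const)
    show "(\<lambda>n. Im (cinner (T u + T (s n)) (u + s n))) \<longlonglongrightarrow> Im (cinner (T u + g) (u + f))"
      by (intro tendsto_Im tendsto_cinner tendsto_add tendsto_const assms)
    show "\<exists>N. \<forall>n\<ge>N. 0 \<le> Im (cinner (T u + T (s n)) (u + s n))"
      using q_nonneg[OF D_add[OF that assms(1)]] that assms(1) by (simp add: T_add)
  qed
  from dissipative_extension_in_graph[OF this] show "f \<in> D" "T f = g"
    by blast+
qed

abbreviation shift :: "complex \<Rightarrow> 'a \<Rightarrow> 'a" where "shift z f \<equiv> T f - z *\<^sub>C f"

lemma shift_diff: "f \<in> D \<Longrightarrow> g \<in> D \<Longrightarrow> shift z (f - g) = shift z f - shift z g"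
  by (simp add: T_diff complex_vector.scale_right_diff_distrib)

lemma shift_scale: "f \<in> D \<Longrightarrow> shift z (c *\<^sub>C f) = c *\<^sub>C shift z f"
  by (simp add: T_scale complex_vector.scale_right_diff_distrib scaleC_scaleC mult.commute)

lemma subspace_shift_image:
  assumes V: "complex_vector.subspace V" "V \<subseteq> D"
  shows "complex_vector.subspace (shift z ` V)"
  unfolding complex_vector.subspace_def
proof (intro conjI ballI allI)
  show "0 \<in> shift z ` V"
    using complex_vector.subspace_0[OF V(1)] by (intro image_eqI[of _ _ 0]) (auto simp: T_zero)
  show "x + y \<in> shift z ` V" if xy: "x \<in> shift z ` V" "y \<in> shift z ` V" for x y
  proof -
    obtain f g where fg: "f \<in> V" "g \<in> V" "x = shift z f" "y = shift z g"
      using xy by blast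
    then have "x + y = shift z (f + g)"
      using V(2) by (auto simp: T_add subset_iff scaleC_add_right)
    then show ?thesis
      using complex_vector.subspace_add[OF V(1)] fg by blast
  qed
  show "c *\<^sub>C x \<in> shift z ` V" if x: "x \<in> shift z ` V" for c x
  proof -
    obtain f where f: "f \<in> V" "x = shift z f"
      using x by blast
    then have "f \<in> D"
      using V(2) by blast
    then have "c *\<^sub>C x = shift z (c *\<^sub>C f)"
      unfolding f(2) by (rule shift_scale[symmetric])
    then show ?thesis
      using complex_vector.subspace_scale[OF V(1)] f by blast
  qed
qed

text \<open>
  The polarised form of the identity behind the Cayley transform: the inner products of the images under
  \<open>T - cnj w\<close> and \<open>T - w\<close> differ by the failure of \<open>T\<close> to be symmetric.
\<close>

lemma cinner_shift_diff:
  "cinner (shift (cnj w) k) (shift (cnj w) s) - cinner (shift w k) (shift w s) =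
    - (2 * \<i> * Im w) * (cinner (T k) s - cinner k (T s))"
proof -
  have w: "2 * \<i> * Im w = w - cnj w"
    by (simp add: complex_eq_iff)
  show ?thesis
    unfolding w by (simp add: cinner_simps algebra_simps)
qed

lemma norm_shift:
  "(norm (shift (cnj w) f))\<^sup>2 = (norm (shift w f))\<^sup>2 + 4 * Im w * q f"
proof -
  have "cinner (T f) f - cinner f (T f) = 2 * \<i> * q f"
    by (subst cinner_commute[of f]) (simp add: complex_eq_iff)
  then have "cinner (shift (cnj w) f) (shift (cnj w) f) - cinner (shift w f) (shift w f) =
      complex_of_real (4 * Im w * q f)"
    by (simp only: cinner_shift_diff) (simp add: complex_eq_iff)
  from arg_cong[where f = Re, OF this] show ?thesis
    by (simp add: power2_norm_eq_cinner)
qed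

lemma shift_bounded_below:
  assumes "f \<in> D" "Im w > 0"
  shows "Im w * norm f \<le> norm (shift (cnj w) f)"
proof (cases "f = 0")
  case False
  have "Im w * (norm f)\<^sup>2 \<le> Im (cinner (shift (cnj w) f) f)"
    using q_nonneg[OF assms(1)] by (simp add: cinner_simps cinner_self flip: of_real_power)
  also have "\<dots> \<le> norm (shift (cnj w) f) * norm f"
    using cauchy_schwarz abs_Im_le_cmod abs_ge_self order_trans by meson
  finally show ?thesis
    using False by (simp add: power2_eq_square)
qed simp

text \<open>
  Since \<open>T - cnj w\<close> is closed and bounded below, convergence of the images forces convergence of the
  preimages in the graph norm.
\<close>

lemma shift_limit:
  assumes s: "\<And>n. s n \<in> D" and w: "Im w > 0"
    and lim: "(\<lambda>n. shift (cnj w) (s n)) \<longlonglongrightarrow> h"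
  obtains f where "f \<in> D" "shift (cnj w) f = h" "s \<longlonglongrightarrow> f" "(\<lambda>n. T (s n)) \<longlonglongrightarrow> T f"
proof -
  have "Cauchy s"
  proof (rule metric_CauchyI)
    fix e :: real assume "0 < e"
    then obtain N where N: "\<And>m n. m \<ge> N \<Longrightarrow> n \<ge> N \<Longrightarrow>
        norm (shift (cnj w) (s m) - shift (cnj w) (s n)) < Im w * e"
      using metric_CauchyD[OF LIMSEQ_imp_Cauchy[OF lim], of "Im w * e"] w
      by (auto simp: dist_norm)
    have "norm (s m - s n) < e" if "m \<ge> N" "n \<ge> N" for m n
    proof -
      have "Im w * norm (s m - s n) < Im w * e"
        using shift_bounded_below[OF D_diff[OF s s] w] N[OF that]
        by (simp only: shift_diff[OF s s]) (meson le_less_trans)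
      then show ?thesis
        using w by simp
    qed
    then show "\<exists>N. \<forall>m\<ge>N. \<forall>n\<ge>N. dist (s m) (s n) < e"
      by (auto simp: dist_norm)
  qed
  then obtain f where f: "s \<longlonglongrightarrow> f"
    by (metis Cauchy_convergent convergent_def)
  have Ts: "(\<lambda>n. T (s n)) \<longlonglongrightarrow> h + cnj w *\<^sub>C f"
    using tendsto_add[OF lim tendsto_scaleC[OF tendsto_const[of "cnj w"] f]] by simp
  from closed_graph[OF s f Ts] f Ts show thesis
    by (intro that[of f]) auto
qed

section \<open>The Hermitian part\<close>

abbreviation S :: "'a set" where "S \<equiv> hermitian_domain D T"

text \<open>
  As the diagonal of a sesquilinear form, \<open>q\<close> satisfies the parallelogram law. Together with
  nonnegativity this gives all that is used below in place of the triangle inequality for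
  \<open>sqrt q\<close>.
\<close>

lemma q_parallelogram:
  assumes "f \<in> D" "g \<in> D"
  shows "q (f + g) + q (f - g) = 2 * q f + 2 * q g"
  using assms by (simp add: T_add T_diff cinner_simps)

lemma q_diff_le:
  assumes "f \<in> D" "g \<in> D"
  shows "q (f - g) \<le> 2 * q f + 2 * q g"
  using q_parallelogram[OF assms] q_nonneg[OF D_add[OF assms]] by linarith

lemma S_subset: "S \<subseteq> D"
  by (auto simp: hermitian_domain_def)

lemma subspace_S: "complex_vector.subspace S"
  unfolding complex_vector.subspace_def
proof (intro conjI ballI allI)
  show "0 \<in> S"
    by (simp add: hermitian_domain_def D_zero)
  show "f + g \<in> S" if "f \<in> S" "g \<in> S" for f g
    using that q_parallelogram[of f g] q_nonneg[of "f + g"] q_nonneg[of "f - g"]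
    by (auto simp: hermitian_domain_def D_add D_diff)
  show "c *\<^sub>C f \<in> S" if "f \<in> S" for c f
    using that by (auto simp: hermitian_domain_def D_scale q_scale)
qed

text \<open>
  The Cauchy--Schwarz inequality for the form \<open>q\<close>: as \<open>q\<close> is nonnegative and vanishes at \<open>s\<close>, the
  term of \<open>q (s + c k)\<close> linear in \<open>c\<close> vanishes.
\<close>

lemma hermitian_symmetric:
  assumes s: "s \<in> S" and k: "k \<in> D"
  shows "cinner (T k) s = cinner k (T s)"
proof -
  have sD: "s \<in> D" and qs: "q s = 0"
    using s by (auto simp: hermitian_domain_def)
  have "- \<i> * (cinner (T k) s - cinner k (T s)) = 0"
  proof (rule zero_if_quadratic_nonneg)
    fix c
    have "0 \<le> q (s + c *\<^sub>C k)"
      using sD k by (simp add: q_nonneg D_add D_scale)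
    also have "q (s + c *\<^sub>C k) =
        q s + Im (c * cinner (T k) s) + Im (cinner (T s) (c *\<^sub>C k)) + q (c *\<^sub>C k)"
      using sD k by (simp add: T_add D_scale cinner_add_left cinner_add_right)
        (simp add: T_scale cinner_scaleC_left)
    also have "Im (cinner (T s) (c *\<^sub>C k)) = - Im (c * cinner k (T s))"
      by (subst cinner_commute) (simp add: cinner_scaleC_left)
    finally show "0 \<le> Re (c * (- \<i> * (cinner (T k) s - cinner k (T s)))) + (cmod c)\<^sup>2 * q k"
      using qs k by (simp add: q_scale algebra_simps)
  qed
  then show ?thesis
    by simp
qed

lemma q_limit:
  assumes "s \<longlonglongrightarrow> f" "(\<lambda>n. T (s n)) \<longlonglongrightarrow> T f" "(\<lambda>n. q (s n)) \<longlonglongrightarrow> 0"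
  shows "q f = 0"
  using LIMSEQ_unique[OF tendsto_Im[OF tendsto_cinner[OF assms(2,1)]] assms(3)] .

lemma closed_range_hermitian:
  assumes w: "Im w > 0"
  shows "closed (shift (cnj w) ` S)"
  unfolding closed_sequential_limits
proof (intro allI impI, elim conjE)
  fix x l assume x: "\<forall>n. x n \<in> shift (cnj w) ` S" "x \<longlonglongrightarrow> l"
  then obtain s where s: "\<And>n. s n \<in> S" "x = (\<lambda>n. shift (cnj w) (s n))"
    by (auto simp: image_iff) metis
  have sD: "\<And>n. s n \<in> D"
    using s(1) S_subset by blast
  obtain f where f: "f \<in> D" "shift (cnj w) f = l" "s \<longlonglongrightarrow> f" "(\<lambda>n. T (s n)) \<longlonglongrightarrow> T f"
    using shift_limit[where s = s and w = w and h = l, OF sD w] x(2) s(2) by blast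
  have "q f = 0"
    using q_limit[OF f(3,4)] s(1) by (simp add: hermitian_domain_def)
  then have "f \<in> S"
    using f(1) by (simp add: hermitian_domain_def)
  then show "l \<in> shift (cnj w) ` S"
    using f(2) by blast
qed

text \<open>
  The Cayley transform maps the complement of its isometric subspace into the complement of the image of
  that subspace.
\<close>

lemma shift_ortho_complement:
  assumes k: "k \<in> D" and "shift (cnj w) k \<in> ortho_complement (shift (cnj w) ` S)"
  shows "shift w k \<in> ortho_complement (shift w ` S)"
proof -
  have "cinner (shift w k) (shift w s) = 0" if s: "s \<in> S" for s
  proof -
    have "cinner (shift (cnj w) k) (shift (cnj w) s) = 0"
      using assms(2) s by (simp add: ortho_complement_def)
    then show ?thesis
      using cinner_shift_diff[where w = w and k = k and s = s] hermitian_symmetric[OF s k] by simp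
  qed
  then show ?thesis
    by (simp add: ortho_complement_def)
qed

text \<open>
  The Cayley transform is contractive, so convergence of \<open>(T - w) (k n)\<close> does not in general give
  convergence of \<open>(T - cnj w) (k n)\<close>. It does when \<open>q (k n) \<rightarrow> 0\<close>, because the defect
  \<open>4 Im w q (k m - k n)\<close> is at most \<open>8 Im w (q (k m) + q (k n))\<close>.
\<close>

lemma shift_cnj_convergent_if_shift_convergent:
  assumes w: "Im w > 0" and k: "\<And>n. k n \<in> D" and q0: "(\<lambda>n. q (k n)) \<longlonglongrightarrow> 0"
    and lim: "(\<lambda>n. shift w (k n)) \<longlonglongrightarrow> e"
  shows "convergent (\<lambda>n. shift (cnj w) (k n))"
proof (rule Cauchy_convergent, rule metric_CauchyI)
  fix \<epsilon> :: real assume \<epsilon>: "0 < \<epsilon>"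
  have "\<forall>\<^sub>F n in sequentially. q (k n) < \<epsilon>\<^sup>2 / (32 * Im w)"
    using w \<epsilon> by (intro order_tendstoD[OF q0]) auto
  then obtain N1 where N1: "\<And>n. n \<ge> N1 \<Longrightarrow> q (k n) < \<epsilon>\<^sup>2 / (32 * Im w)"
    by (auto simp: eventually_sequentially)
  obtain N2 where N2: "\<And>m n. m \<ge> N2 \<Longrightarrow> n \<ge> N2 \<Longrightarrow>
      norm (shift w (k m) - shift w (k n)) < \<epsilon> / 2"
    using metric_CauchyD[OF LIMSEQ_imp_Cauchy[OF lim], of "\<epsilon> / 2"] \<epsilon> by (auto simp: dist_norm)
  have "norm (shift (cnj w) (k m) - shift (cnj w) (k n)) < \<epsilon>"
    if "m \<ge> max N1 N2" "n \<ge> max N1 N2" for m n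
  proof (rule power2_less_imp_less)
    have "(norm (shift w (k m) - shift w (k n)))\<^sup>2 < (\<epsilon> / 2)\<^sup>2"
      using that by (intro power_strict_mono N2) auto
    then have "(norm (shift w (k m) - shift w (k n)))\<^sup>2 < \<epsilon>\<^sup>2 / 4"
      by (simp add: power_divide)
    moreover have "4 * Im w * q (k m - k n) < \<epsilon>\<^sup>2 / 2"
    proof -
      have "q (k m - k n) < \<epsilon>\<^sup>2 / (8 * Im w)"
        using q_diff_le[OF k[of m] k[of n]] N1[of m] N1[of n] that by simp
      then show ?thesis
        using w by (simp add: field_simps)
    qed
    moreover have "(norm (shift (cnj w) (k m) - shift (cnj w) (k n)))\<^sup>2 =
        (norm (shift w (k m) - shift w (k n)))\<^sup>2 + 4 * Im w * q (k m - k n)"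
      using norm_shift[where w = w and f = "k m - k n"] unfolding shift_diff[OF k k] .
    ultimately show "(norm (shift (cnj w) (k m) - shift (cnj w) (k n)))\<^sup>2 < \<epsilon>\<^sup>2"
      using zero_less_power[OF \<epsilon>, of 2] by linarith
  qed (use \<epsilon> in simp)
  then show "\<exists>N. \<forall>m\<ge>N. \<forall>n\<ge>N.
      dist (shift (cnj w) (k m)) (shift (cnj w) (k n)) < \<epsilon>"
    unfolding dist_norm by blast
qed

text \<open>
  The estimate always concerns \<open>T - cnj w\<close> and the complement of \<open>(T - cnj w) S\<close>, while the
  finite-dimensional space may be either deficiency space. This is how both signs of the index are
  treated at once. Normalised counterexamples to the estimate would converge to a unit vector that
  is orthogonal to itself.
\<close>

lemma coercive_if_finite_deficiency:
  assumes w: "Im w > 0" and z: "z = w \<or> z = cnj w"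
    and fin: "cdim (ortho_complement (shift z ` S)) \<noteq> \<infinity>"
  obtains c where "c > 0" "\<And>k. k \<in> D \<Longrightarrow>
    shift (cnj w) k \<in> ortho_complement (shift (cnj w) ` S) \<Longrightarrow>
    c * (norm (shift (cnj w) k))\<^sup>2 \<le> q k"
proof (rule ccontr)
  let ?A = "shift (cnj w)" let ?M = "shift (cnj w) ` S"
  assume "\<not> thesis"
  then have "\<exists>k\<in>D. ?A k \<in> ortho_complement ?M \<and> q k < inverse (Suc n) * (norm (?A k))\<^sup>2" for n
    using that[of "inverse (Suc n)"] by (force simp: not_le)
  then obtain g where g: "\<And>n. g n \<in> D" "\<And>n. ?A (g n) \<in> ortho_complement ?M"
    "\<And>n. q (g n) < inverse (Suc n) * (norm (?A (g n)))\<^sup>2"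
    by metis
  have A0: "?A (g n) \<noteq> 0" for n
  proof
    assume "?A (g n) = 0"
    then show False
      using g(3)[of n] q_nonneg[OF g(1)[of n]] by (simp only: norm_zero) simp
  qed
  define k where "k n = complex_of_real (inverse (norm (?A (g n)))) *\<^sub>C g n" for n
  have k: "k n \<in> D" for n
    by (simp add: k_def D_scale g(1))
  have Ak: "?A (k n) = complex_of_real (inverse (norm (?A (g n)))) *\<^sub>C ?A (g n)" for n
    unfolding k_def by (rule shift_scale[OF g(1)])
  have k_perp: "?A (k n) \<in> ortho_complement ?M" for n
    unfolding Ak by (intro complex_vector.subspace_scale[OF subspace_ortho_complement] g(2))
  have k_norm: "norm (?A (k n)) = 1" for n
    unfolding Ak norm_scaleC using A0[of n] by (simp add: norm_inverse)
  have qk: "q (k n) \<le> inverse (Suc n)" for n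
  proof -
    have "q (k n) = (inverse (norm (?A (g n))))\<^sup>2 * q (g n)"
      unfolding k_def by (subst q_scale[OF g(1)]) (simp add: norm_inverse)
    also have "\<dots> \<le> (inverse (norm (?A (g n))))\<^sup>2 * (inverse (Suc n) * (norm (?A (g n)))\<^sup>2)"
      by (rule mult_left_mono[OF less_imp_le[OF g(3)]]) simp
    also have "\<dots> = inverse (Suc n)"
      using A0[of n] by (simp add: power2_eq_square field_simps)
    finally show ?thesis .
  qed
  have q0: "(\<lambda>n. q (k n)) \<longlonglongrightarrow> 0"
    by (rule tendsto_sandwich[OF _ _ tendsto_const LIMSEQ_inverse_real_of_nat])
      (intro always_eventually allI q_nonneg k qk)+
  have mem: "shift z (k n) \<in> ortho_complement (shift z ` S)" for n
    using z k_perp shift_ortho_complement[OF k k_perp] by blast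
  have bound: "norm (shift z (k n)) \<le> 1" for n
  proof -
    have "(norm (shift w (k n)))\<^sup>2 \<le> 1"
      using norm_shift[where w = w and f = "k n"] q_nonneg[OF k[of n]] w k_norm[of n]
      by (smt (verit) mult_nonneg_nonneg one_power2)
    then have "norm (shift w (k n)) \<le> 1"
      by (simp add: power2_le_iff_abs_le[of 1, simplified] abs_square_le_1)
    then show ?thesis
      using z k_norm by auto
  qed
  obtain l \<rho> where \<rho>: "strict_mono \<rho>" "((\<lambda>n. shift z (k n)) \<circ> \<rho>) \<longlonglongrightarrow> l"
    using finite_cdim_convergent_subseq[of _ "\<lambda>n. shift z (k n)", OF fin mem bound] by blast
  have q\<rho>: "(\<lambda>n. q (k (\<rho> n))) \<longlonglongrightarrow> 0"
    using LIMSEQ_subseq_LIMSEQ[OF q0 \<rho>(1)] by (simp add: o_def)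
  have "convergent (\<lambda>n. ?A (k (\<rho> n)))"
    using z
  proof
    assume "z = w"
    then show ?thesis
      using shift_cnj_convergent_if_shift_convergent[OF w k q\<rho>] \<rho>(2) by (simp add: o_def)
  next
    assume "z = cnj w"
    then show ?thesis
      using \<rho>(2) by (auto simp: o_def convergent_def)
  qed
  then obtain h where h: "(\<lambda>n. ?A (k (\<rho> n))) \<longlonglongrightarrow> h"
    by (auto simp: convergent_def)
  obtain f where f: "f \<in> D" "?A f = h" "(\<lambda>n. k (\<rho> n)) \<longlonglongrightarrow> f" "(\<lambda>n. T (k (\<rho> n))) \<longlonglongrightarrow> T f"
    using shift_limit[of "\<lambda>n. k (\<rho> n)", OF k w h] by blast
  have "f \<in> S"
    using q_limit[OF f(3,4) q\<rho>] f(1) by (simp add: hermitian_domain_def)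
  then have "h \<in> ?M"
    using f(2) by blast
  moreover have "h \<in> ortho_complement ?M"
    using closed_sequentially[OF closed_ortho_complement _ h] k_perp by blast
  ultimately have "cinner h h = 0"
    unfolding ortho_complement_def by blast
  moreover have "norm h = 1"
    using tendsto_norm[OF h] by (simp add: k_norm LIMSEQ_const_iff)
  ultimately show False
    by (simp add: cinner_self)
qed

text \<open>
  Coercivity turns an approximating sequence \<open>s n\<close> with \<open>q (s n) \<rightarrow> 0\<close> into an approximating sequence
  in \<open>S\<close>: it is \<open>s n\<close> minus a correction that tends to \<open>0\<close> in norm.
\<close>

theorem dense_hermitian_domain_if_finite_deficiency:
  assumes sing: "D_sing D T"
    and w: "Im w > 0" and z: "z = w \<or> z = cnj w"
    and fin: "cdim (ortho_complement (shift z ` S)) \<noteq> \<infinity>"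
  shows "closure S = UNIV"
proof -
  let ?A = "shift (cnj w)" let ?M = "shift (cnj w) ` S"
  obtain c where c: "c > 0" and coercive: "\<And>k. k \<in> D \<Longrightarrow> ?A k \<in> ortho_complement ?M \<Longrightarrow>
      c * (norm (?A k))\<^sup>2 \<le> q k"
    using coercive_if_finite_deficiency[OF w z fin] by blast
  have "f \<in> closure S" if f: "f \<in> D" for f
  proof -
    obtain s where s: "\<And>n. s n \<in> D" "s \<longlonglongrightarrow> f" "(\<lambda>n. q (s n)) \<longlonglongrightarrow> 0"
      using sing f by (auto simp: D_sing_def)
    have "\<exists>a\<in>S. \<exists>p\<in>ortho_complement ?M. ?A (s n) = ?A a + p" for n
      using orthogonal_decomposition[where x = "?A (s n)",
          OF subspace_shift_image[OF subspace_S S_subset] closed_range_hermitian[OF w]] by blast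
    then obtain a where a: "\<And>n. a n \<in> S"
      and perp: "\<And>n. ?A (s n) - ?A (a n) \<in> ortho_complement ?M"
      by (metis add_diff_cancel_left')
    have aD: "a n \<in> D" for n
      using a S_subset by blast
    have bound: "(norm (s n - a n))\<^sup>2 \<le> 2 / (c * (Im w)\<^sup>2) * q (s n)" for n
    proof -
      have d: "s n - a n \<in> D"
        by (intro D_diff s(1) aD)
      have "c * (Im w * norm (s n - a n))\<^sup>2 \<le> c * (norm (?A (s n - a n)))\<^sup>2"
        using c w by (intro mult_left_mono power_mono shift_bounded_below d) auto
      also have "\<dots> \<le> q (s n - a n)"
        using perp[of n] by (intro coercive d) (simp only: shift_diff[OF s(1) aD])
      also have "\<dots> \<le> 2 * q (s n)"
        using q_diff_le[OF s(1) aD, of n n] a[of n] by (simp add: hermitian_domain_def)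
      finally show ?thesis
        using c w by (simp add: field_simps power_mult_distrib)
    qed
    have "(\<lambda>n. (norm (s n - a n))\<^sup>2) \<longlonglongrightarrow> 0"
      by (rule tendsto_sandwich[OF _ _ tendsto_const
            tendsto_mult_right_zero[OF s(3), of "2 / (c * (Im w)\<^sup>2)"]])
        (intro always_eventually allI zero_le_power2 bound)+
    then have "(\<lambda>n. s n - a n) \<longlonglongrightarrow> 0"
      by (simp add: tendsto_norm_zero_iff)
    from tendsto_diff[OF s(2) this] have "a \<longlonglongrightarrow> f"
      by simp
    then show ?thesis
      using a by (auto simp: closure_sequential)
  qed
  then have "closure D \<subseteq> closure S"
    by (simp add: closure_minimal subsetI)
  then show ?thesis
    using dense by (auto simp: densely_defined_def)
qed

end

theorem corollary4p6:
  fixes D :: "'a::complex_hilbert_space set" and T :: "'a \<Rightarrow> 'a"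
  assumes "densely_defined D T"
    and "maximal_dissipative D T"
    and "D_sing D T"
    and "hermitian_domain D T \<noteq> {0}"
    and "closure (hermitian_domain D T) \<noteq> UNIV"
  shows "(\<forall>z. Im z > 0 \<longrightarrow> deficiency_index (hermitian_domain D T) T z = \<infinity>) \<and>
         (\<forall>z. Im z < 0 \<longrightarrow> deficiency_index (hermitian_domain D T) T z = \<infinity>)"
proof -
  interpret dense_maximal_dissipative D T
    using assms(1,2) by unfold_locales
  \<comment> \<open>The index at \<open>z\<close> involves the range of \<open>T - cnj z\<close> on \<open>S\<close>; the auxiliary point \<open>w\<close> is
    whichever of \<open>z\<close> and \<open>cnj z\<close> lies in the upper half plane.\<close>
  have "deficiency_index S T z = \<infinity>" if "Im z > 0" for z
    using dense_hermitian_domain_if_finite_deficiency[OF assms(3) that, of "cnj z"] assms(5)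
    unfolding deficiency_index_def by blast
  moreover have "deficiency_index S T z = \<infinity>" if "Im z < 0" for z
    using dense_hermitian_domain_if_finite_deficiency[OF assms(3), of "cnj z" "cnj z"] assms(5) that
    unfolding deficiency_index_def by auto
  ultimately show ?thesis
    by blast
qed

end
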